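(* Let $p$ be a prime, $g$ a positive integer and $q=p^{g}$. Let $\mathfrak{m}_n(\mathfrak{x})\in\mathbb{Z}[\mathfrak{x}]$ ($n\ge 0$) and $\mathfrak{f}^{[i]}(\mathfrak{x})\in\mathbb{Z}[\mathfrak{x}]$ ($i\geq 0$) be the polynomials defined in the context. Then $\mathfrak{f}^{[g]}(\mathfrak{x})=\mathfrak{m}_{q}(\mathfrak{x})-\mathfrak{m}_{q-2}(\mathfrak{x})$, so that $$\mathfrak{f}^{[g]}(\mathfrak{x})=\sum_{j=0}^{\lfloor q/2\rfloor}(-1)^{j}\,\frac{q}{q-j}\binom{q-j}{j}\,\mathfrak{x}^{q-2j}.$$
   Context: The polynomials $\mathfrak{m}_n(\mathfrak{x})\in\mathbb{Z}[\mathfrak{x}]$ are defined by $\mathfrak{m}_{0}(\mathfrak{x})=1$, $\mathfrak{m}_{1}(\mathfrak{x})=\mathfrak{x}$, $\mathfrak{m}_{2}(\mathfrak{x})=\mathfrak{x}^{2}-1$, and $\mathfrak{m}_{n}(\mathfrak{x})=\mathfrak{x}\cdot\mathfrak{m}_{n-1}(\mathfrak{x})-\mathfrak{m}_{n-2}(\mathfrak{x})$ for $n>2$. The polynomials $\mathfrak{f}^{[i]}(\mathfrak{x})\in\mathbb{Z}[\mathfrak{x}]$, depending on $p$, are defined by $\mathfrak{f}^{[0]}(\mathfrak{x})=\mathfrak{x}$, $\mathfrak{f}^{[1]}(\mathfrak{x})=\mathfrak{m}_{p}(\mathfrak{x})-\mathfrak{m}_{p-2}(\mathfrak{x})$, and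 $\mathfrak{f}^{[i]}(\mathfrak{x})=(\mathfrak{f}^{[1]}\circ\mathfrak{f}^{[i-1]})(\mathfrak{x})$ for $i>1$ (so $\mathfrak{f}^{[i]}$ is the $i$-fold composition of $\mathfrak{f}^{[1]}$ with itself). *)

theory Defs
  imports "HOL-Computational_Algebra.Computational_Algebra"
begin

text \<open>Throughout, the indeterminate is the polynomial \<open>[:0, 1:]\<close>.\<close>

fun m_poly :: "nat \<Rightarrow> int poly" where
  "m_poly 0 = 1"
| "m_poly (Suc 0) = [:0, 1:]"
| "m_poly (Suc (Suc 0)) = [:0, 1:] ^ 2 - 1"
| "m_poly (Suc (Suc (Suc n))) = [:0, 1:] * m_poly (Suc (Suc n)) - m_poly (Suc n)"

text \<open>The index \<open>p - 2\<close> is a truncated subtraction on natural numbers; it has its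
  intended meaning for \<open>p \<ge> 2\<close>, in particular for every prime \<open>p\<close>.\<close>

fun f_poly :: "nat \<Rightarrow> nat \<Rightarrow> int poly" where
  "f_poly p 0 = [:0, 1:]"
| "f_poly p (Suc 0) = m_poly p - m_poly (p - 2)"
| "f_poly p (Suc (Suc i)) = pcompose (f_poly p (Suc 0)) (f_poly p (Suc i))"

end

theory Submission
  imports Defs
begin

text \<open>The differences \<open>m\<^sub>n - m\<^bsub>n-2\<^esub>\<close> are the Dickson polynomials \<open>D\<^sub>n\<close>, characterised by
  \<open>D\<^sub>n(t + 1/t) = t\<^sup>n + 1/t\<^sup>n\<close>. Hence \<open>D\<^sub>m \<circ> D\<^sub>n = D\<^bsub>mn\<^esub>\<close>, which we obtain from the
  product formula \<open>D\<^sub>m D\<^sub>n = D\<^bsub>m+n\<^esub> + D\<^bsub>m-n\<^esub>\<close>. The explicit formula comes from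
  \<open>m\<^sub>n = \<Sum>\<^sub>j (-1)\<^sup>j binom(n-j, j) x\<^bsup>n-2j\<^esup>\<close> together with the absorption identity
  for binomial coefficients.\<close>

fun dickson :: "nat \<Rightarrow> int poly" where
  "dickson 0 = 2"
| "dickson (Suc 0) = [:0, 1:]"
| "dickson (Suc (Suc n)) = [:0, 1:] * dickson (Suc n) - dickson n"

text \<open>The value \<open>x^2 - 1\<close> at index 2 already fits the recurrence, so one rule
  covers every index from 2 on.\<close>

lemma m_poly_rec: "m_poly (Suc (Suc n)) = [:0, 1:] * m_poly (Suc n) - m_poly n"
  by (cases n) (simp_all add: power2_eq_square)

lemma m_poly_diff_eq_dickson: "m_poly (Suc (Suc n)) - m_poly n = dickson (Suc (Suc n))"
proof (induction n rule: dickson.induct)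
  case 1
  show ?case by (simp add: power2_eq_square)
next
  case 2
  show ?case by (simp add: m_poly_rec power2_eq_square algebra_simps flip: one_pCons)
next
  case (3 n)
  have "m_poly (Suc (Suc (Suc (Suc n)))) - m_poly (Suc (Suc n)) =
      [:0, 1:] * (m_poly (Suc (Suc (Suc n))) - m_poly (Suc n))
      - (m_poly (Suc (Suc n)) - m_poly n)"
    by (subst (1 3) m_poly_rec) (simp only: m_poly_rec[of n] algebra_simps)
  then show ?case
    by (simp only: 3 dickson.simps(3))
qed

text \<open>This is \<open>(t^n + t^-n) * (t^m + t^-m)\<close> expanded; the value 2 at index 0 is
  what makes \<open>n = 0\<close> and \<open>m = n\<close> fit.\<close>

lemma dickson_mult: "n \<le> m \<Longrightarrow> dickson n * dickson m = dickson (m + n) + dickson (m - n)"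
proof (induction n rule: dickson.induct)
  case 1
  show ?case by simp
next
  case 2
  then obtain k where "m = Suc k" by (cases m) auto
  then show ?case by simp
next
  case (3 n)
  \<comment> \<open>With \<open>k = m - n - 2\<close> the lower indices become \<open>k\<close>,
    \<open>k + 1\<close>, \<open>k + 2\<close>, free of subtraction; the recurrence is later read
    downwards to reach \<open>dickson k\<close>.\<close>
  obtain k where m: "m = Suc (Suc (k + n))"
    using "3.prems" by (metis add_Suc less_eqE add.commute)
  have "dickson (Suc (Suc n)) * dickson m
      = [:0, 1:] * (dickson (Suc n) * dickson m) - dickson n * dickson m"
    by (simp only: dickson.simps(3) algebra_simps)
  also have "\<dots> = [:0, 1:] * (dickson (Suc (m + n)) + dickson (Suc k))
      - (dickson (m + n) + dickson (Suc (Suc k)))"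
    using "3.IH" by (simp add: m del: dickson.simps)
  also have "\<dots> = dickson (Suc (Suc (m + n))) + dickson k"
    by (simp only: dickson.simps(3) algebra_simps)
  finally show ?case by (simp add: m del: dickson.simps)
qed

text \<open>Substitution respects ring operations, so the recurrence in \<open>m\<close> turns into
  multiplication by \<open>dickson n\<close>, which the product formula evaluates because
  \<open>n \<le> Suc m * n\<close>.\<close>

lemma dickson_pcompose: "pcompose (dickson m) (dickson n) = dickson (m * n)"
proof (induction m rule: dickson.induct)
  case 1
  show ?case by (metis dickson.simps(1) mult_0 pcompose_const numeral_poly)
next
  case 2
  show ?case by (simp add: pcompose_pCons)
next
  case (3 m)
  have "pcompose (dickson (Suc (Suc m))) (dickson n)
      = dickson n * dickson (Suc m * n) - dickson (m * n)"
    by (simp only: dickson.simps(3) pcompose_diff pcompose_mult 3) (simp add: pcompose_pCons)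
  also have "\<dots> = dickson (Suc (Suc m) * n)"
    by (subst dickson_mult) (simp_all add: algebra_simps)
  finally show ?case .
qed

lemma f_poly_eq_dickson:
  assumes "p \<ge> 2"
  shows "f_poly p g = dickson (p ^ g)"
proof -
  obtain k where "p = Suc (Suc k)"
    using assms by (metis add_2_eq_Suc less_eqE)
  then have f_1: "f_poly p (Suc 0) = dickson p"
    using m_poly_diff_eq_dickson[of k] by (simp del: dickson.simps m_poly.simps)
  show ?thesis
  proof (induction g rule: dickson.induct)
    case 1
    show ?case by simp
  next
    case 2
    show ?case using f_1 by simp
  next
    case (3 g)
    show ?case
      by (simp only: f_poly.simps(3) f_1 3 dickson_pcompose power_Suc)
  qed
qed

text \<open>For \<open>2 * j > n\<close> the exponent truncates to 0, but then
  \<open>n - j < j\<close> and the coefficient vanishes, so sums may run past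
  \<open>n div 2\<close>.\<close>

definition m_term :: "nat \<Rightarrow> nat \<Rightarrow> int poly" where
  "m_term n j = monom ((-1) ^ j * int ((n - j) choose j)) (n - 2 * j)"

text \<open>Pascal's rule: one summand belongs to \<open>x\<close> times the term at
  \<open>Suc n\<close>, the other to the term at \<open>n\<close>, with the sign absorbed by the
  shift in \<open>j\<close>.\<close>

lemma m_term_Suc_Suc:
  assumes "j \<le> n"
  shows "m_term (Suc (Suc n)) (Suc j) = [:0, 1:] * m_term (Suc n) (Suc j) - m_term n j"
proof -
  have pascal: "Suc n - j choose Suc j = (n - j choose Suc j) + (n - j choose j)"
    using assms by (simp add: Suc_diff_le)
  have shift: "[:0, 1:] * m_term (Suc n) (Suc j)
      = monom (- ((-1) ^ j) * int (n - j choose Suc j)) (n - 2 * j)"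
  \<comment> \<open>Multiplying by \<open>x\<close> raises the exponent correctly only if it was not
    truncated; otherwise both coefficients are 0.\<close>
  proof (cases "2 * j < n")
    case True
    then have "Suc (n - Suc (2 * j)) = n - 2 * j" by simp
    then show ?thesis by (simp add: m_term_def flip: monom_Suc)
  next
    case False
    then show ?thesis by (simp add: m_term_def binomial_eq_0)
  qed
  show ?thesis
    unfolding shift by (simp add: m_term_def pascal diff_monom algebra_simps)
qed

lemma m_term_Suc_0: "m_term (Suc n) 0 = [:0, 1:] * m_term n 0"
  by (simp add: m_term_def monom_Suc)

lemma m_term_eq_0:
  assumes "n < 2 * j" "j \<le> n"
  shows "m_term n j = 0"
  using assms by (simp add: m_term_def binomial_eq_0)

lemma m_poly_eq_sum: "m_poly n = (\<Sum>j\<le>n. m_term n j)"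
proof (induction n rule: dickson.induct)
  case 1
  show ?case by (simp add: m_term_def)
next
  case 2
  show ?case by (simp add: m_term_def monom_altdef)
next
  case (3 n)
  \<comment> \<open>The term \<open>j = 0\<close> has no partner in the sum for \<open>n\<close>,
    and the top term \<open>j = n + 2\<close> vanishes.\<close>
  have "(\<Sum>j\<le>Suc (Suc n). m_term (Suc (Suc n)) j)
      = m_term (Suc (Suc n)) 0 + (\<Sum>j\<le>n. m_term (Suc (Suc n)) (Suc j))"
    by (subst sum.atMost_Suc_shift) (simp add: m_term_eq_0)
  also have "\<dots> = [:0, 1:] * (m_term (Suc n) 0 + (\<Sum>j\<le>n. m_term (Suc n) (Suc j)))
      - (\<Sum>j\<le>n. m_term n j)"
    by (simp add: m_term_Suc_0 m_term_Suc_Suc sum_subtractf sum_distrib_left distrib_left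
        del: mult_pCons_left)
  also have "\<dots> = m_poly (Suc (Suc n))"
    by (simp only: m_poly_rec 3 sum.atMost_Suc_shift)
  finally show ?case ..
qed

text \<open>Write \<open>n / (n - j)\<close> as \<open>1 + j / (n - j)\<close> and absorb the factor
  \<open>j\<close> into the binomial coefficient.\<close>

lemma rat_dickson_coeff:
  assumes "0 < j" "2 * j \<le> n"
  shows "rat_of_nat n / rat_of_nat (n - j) * rat_of_nat (n - j choose j)
    = rat_of_nat (n - j choose j) + rat_of_nat (n - j - 1 choose (j - 1))"
proof -
  have "j * (n - j choose j) = (n - j) * (n - j - 1 choose (j - 1))"
    using times_binomial_minus1_eq[of j "n - j"] assms by simp
  then have "rat_of_nat j * rat_of_nat (n - j choose j)
      = rat_of_nat (n - j) * rat_of_nat (n - j - 1 choose (j - 1))"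
    by (metis of_nat_mult)
  moreover have "rat_of_nat (n - j) = rat_of_nat n - rat_of_nat j" "rat_of_nat (n - j) \<noteq> 0"
    using assms by (auto simp: of_nat_diff)
  ultimately show ?thesis by (simp add: field_simps)
qed

lemma map_poly_rat_add:
  "map_poly rat_of_int (p + q) = map_poly rat_of_int p + map_poly rat_of_int q"
  by (intro poly_eqI) (simp add: coeff_map_poly)

lemma map_poly_rat_sum:
  "map_poly rat_of_int (\<Sum>i\<in>A. f i) = (\<Sum>i\<in>A. map_poly rat_of_int (f i))"
  by (intro poly_eqI) (simp add: coeff_map_poly coeff_sum)

text \<open>Term \<open>j + 1\<close> of \<open>m_poly n\<close> and term \<open>j\<close> of
  \<open>m_poly (n - 2)\<close> have the same exponent, so their coefficients combine;
  \<open>x^n\<close> stays alone. The passage to rationals gives the quotient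
  \<open>n / (n - j)\<close> its exact meaning.\<close>

lemma dickson_sum:
  assumes "n \<ge> 2"
  shows "map_poly rat_of_int (dickson n) =
    (\<Sum>j = 0..n div 2.
       monom ((-1) ^ j * (rat_of_nat n / rat_of_nat (n - j)) * rat_of_nat (n - j choose j))
             (n - 2 * j))"
proof -
  obtain k where n: "n = Suc (Suc k)"
    using assms by (metis add_2_eq_Suc less_eqE)
  \<comment> \<open>Cut at half the index, the two ranges differ by exactly one, and
    \<open>2 * j \<le> n\<close> holds throughout, as the coefficient identity requires.\<close>
  have half: "(\<Sum>j\<le>m. m_term m j) = (\<Sum>j\<le>m div 2. m_term m j)" for m
    by (rule sum.mono_neutral_right) (auto intro!: m_term_eq_0)
  have "dickson n = (\<Sum>j\<le>n div 2. m_term n j) - (\<Sum>j\<le>k div 2. m_term k j)"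
    by (simp only: n half m_poly_eq_sum flip: m_poly_diff_eq_dickson)
  also have "\<dots> = m_term n 0 + (\<Sum>j\<le>k div 2. m_term n (Suc j) - m_term k j)"
    by (simp add: n sum.atMost_Suc_shift sum_subtractf del: sum.atMost_Suc)
  finally have dickson_n: "dickson n = m_term n 0 + (\<Sum>j\<le>k div 2. m_term n (Suc j) - m_term k j)" .
  define u where "u j = monom ((-1) ^ j * (rat_of_nat n / rat_of_nat (n - j))
    * rat_of_nat (n - j choose j)) (n - 2 * j)" for j
  have u_0: "map_poly rat_of_int (m_term n 0) = u 0"
    by (simp add: m_term_def u_def map_poly_monom n)
  have u_Suc: "map_poly rat_of_int (m_term n (Suc j) - m_term k j) = u (Suc j)"
    if "j \<le> k div 2" for j
  proof -
    have "rat_of_nat n / rat_of_nat (n - Suc j) * rat_of_nat (n - Suc j choose Suc j)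
        = rat_of_nat (n - Suc j choose Suc j) + rat_of_nat (k - j choose j)"
      using rat_dickson_coeff[of "Suc j" n] that by (simp add: n)
    moreover have "m_term n (Suc j) - m_term k j = monom ((-1) ^ Suc j
        * (int (n - Suc j choose Suc j) + int (k - j choose j))) (n - 2 * Suc j)"
      by (simp add: m_term_def n diff_monom algebra_simps)
    ultimately show ?thesis
      by (simp add: u_def map_poly_monom mult.assoc del: power_Suc binomial_Suc_Suc
          times_divide_eq_left times_divide_eq_right)
  qed
  have "map_poly rat_of_int (dickson n) = u 0 + (\<Sum>j\<le>k div 2. u (Suc j))"
    by (simp add: dickson_n map_poly_rat_add map_poly_rat_sum u_0 u_Suc)
  also have "\<dots> = (\<Sum>j = 0..n div 2. u j)"
    by (simp add: n sum.atMost_Suc_shift atLeast0AtMost del: sum.atMost_Suc)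
  finally show ?thesis by (simp add: u_def)
qed

theorem proposition3p9:
  fixes p g q :: nat
  assumes "prime p" and "g > 0" and "q = p ^ g"
  shows "f_poly p g = m_poly q - m_poly (q - 2)
    \<and> map_poly rat_of_int (f_poly p g) =
        (\<Sum>j = 0..q div 2.
           monom ((-1) ^ j * (rat_of_nat q / rat_of_nat (q - j)) * rat_of_nat ((q - j) choose j))
                 (q - 2 * j))"
proof -
  have p: "p \<ge> 2" using assms(1) by (rule prime_ge_2_nat)
  \<comment> \<open>Here \<open>g > 0\<close> enters: it gives \<open>q \<ge> 2\<close>, so that
    \<open>q - 2\<close> is a genuine difference.\<close>
  also have "p \<le> q" using assms p by (simp add: self_le_power)
  finally have q: "q \<ge> 2" .
  then obtain k where "q = Suc (Suc k)" by (metis add_2_eq_Suc less_eqE)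
  then have "m_poly q - m_poly (q - 2) = dickson q"
    using m_poly_diff_eq_dickson[of k] by (simp del: dickson.simps m_poly.simps)
  moreover have "f_poly p g = dickson q"
    using f_poly_eq_dickson[OF p] assms(3) by simp
  ultimately show ?thesis
    using dickson_sum[OF q] by simp
qed

end
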